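(* Let $\mathscr S\colon C[0,2\pi]\to C[0,2\pi]$ be the operator $(\mathscr S f)(x)=\int_0^{2\pi} f(t)(1+\cos(x-t))\,dt$, and let $C_{\mathscr S}=\operatorname{ran}\mathscr S\cap C[0,2\pi]_+$ be its range cone. Then the cone $\mathscr S(C[0,2\pi]_+)$ is (norm) dense in $C_{\mathscr S}$, and it is not finitely generated in $C[0,2\pi]$.
   Context: $C[0,2\pi]$ is the Banach lattice of real continuous functions on $[0,2\pi]$ with the sup norm and pointwise order; $C[0,2\pi]_+$ is the cone of nonnegative functions. A cone $K$ in a vector space is finitely generated if there is a finite set $S\subseteq K$ such that every element of $K$ is a linear combination of elements of $S$ with nonnegative coefficients. *)

theory Defs
  imports "HOL-Analysis.Analysis"
begin

text \<open>The compact interval as a metric space (with the metric inherited from the real line), so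
  that \<open>C[0,2\<pi>]\<close> is an instance of the library's space of bounded continuous functions with the
  sup norm. Boundedness is automatic, see \<open>bcontfun_interval_iff\<close>.\<close>

typedef interval = "{0..2 * pi}"
  morphisms pos_of at_pos
  by (rule exI[of _ 0]) auto

instantiation interval :: metric_space
begin

definition dist_interval :: "interval \<Rightarrow> interval \<Rightarrow> real" where
  "dist_interval x y = dist (pos_of x) (pos_of y)"

definition uniformity_interval :: "(interval \<times> interval) filter" where
  "uniformity_interval = (INF e\<in>{0 <..}. principal {(x, y). dist x y < e})"

definition open_interval :: "interval set \<Rightarrow> bool" where
  "open_interval U = (\<forall>x\<in>U. eventually (\<lambda>(x', y). x' = x \<longrightarrow> y \<in> U) uniformity)"

instance
proof
  fix x y z :: interval
  show "(dist x y = 0) = (x = y)"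
    by (simp add: dist_interval_def pos_of_inject)
  show "dist x y \<le> dist x z + dist y z"
    by (simp add: dist_interval_def dist_triangle2)
qed (simp_all only: uniformity_interval_def open_interval_def)

end

lemma continuous_on_pos_of: "continuous_on A pos_of"
  unfolding continuous_on_iff by (auto simp: dist_interval_def)

lemma continuous_on_at_pos: "continuous_on {0..2 * pi} at_pos"
  unfolding continuous_on_iff dist_interval_def
  by (metis at_pos_inverse)

lemma compact_UNIV_interval: "compact (UNIV :: interval set)"
proof -
  have "UNIV = at_pos ` {0..2 * pi}"
    using pos_of pos_of_inverse by (metis UNIV_eq_I image_eqI)
  then show ?thesis
    using compact_continuous_image[OF continuous_on_at_pos compact_Icc] by simp
qed

lemma bcontfun_interval_iff:
  fixes f :: "interval \<Rightarrow> real"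
  shows "f \<in> bcontfun \<longleftrightarrow> continuous_on UNIV f"
  using compact_continuous_image[of UNIV f, OF _ compact_UNIV_interval]
  by (auto simp: bcontfun_def intro: compact_imp_bounded)

type_synonym C_interval = "interval \<Rightarrow>\<^sub>C real"

definition C_plus :: "C_interval set" where
  "C_plus = {f. \<forall>x. 0 \<le> apply_bcontfun f x}"

lemma kernel_integral_continuous:
  fixes f :: "interval \<Rightarrow> real"
  assumes "continuous_on UNIV f"
  shows "continuous_on UNIV
    (\<lambda>x. integral {0..2 * pi} (\<lambda>t. f (at_pos t) * (1 + cos (pos_of x - t))))"
proof -
  have f: "continuous_on {0..2 * pi} (\<lambda>t. f (at_pos t))"
    using continuous_on_compose2[OF assms continuous_on_at_pos] by simp
  have "integral {0..2 * pi} (\<lambda>t. f (at_pos t) * (1 + cos (pos_of x - t)))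
      = integral {0..2 * pi} (\<lambda>t. f (at_pos t))
      + (cos (pos_of x) * integral {0..2 * pi} (\<lambda>t. f (at_pos t) * cos t)
       + sin (pos_of x) * integral {0..2 * pi} (\<lambda>t. f (at_pos t) * sin t))" for x
  proof -
    have 1: "(\<lambda>t. f (at_pos t)) integrable_on {0..2 * pi}"
      by (intro integrable_continuous_interval f)
    have 2: "(\<lambda>t. cos (pos_of x) * (f (at_pos t) * cos t)) integrable_on {0..2 * pi}"
      by (intro integrable_continuous_interval continuous_intros f)
    have 3: "(\<lambda>t. sin (pos_of x) * (f (at_pos t) * sin t)) integrable_on {0..2 * pi}"
      by (intro integrable_continuous_interval continuous_intros f)
    have "(\<lambda>t. f (at_pos t) * (1 + cos (pos_of x - t)))
        = (\<lambda>t. f (at_pos t) + (cos (pos_of x) * (f (at_pos t) * cos t)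
                            + sin (pos_of x) * (f (at_pos t) * sin t)))"
      by (auto simp: cos_diff algebra_simps)
    then show ?thesis
      by (simp add: integral_add[OF 1 integrable_add[OF 2 3]] integral_add[OF 2 3])
  qed
  then show ?thesis
    by (simp only:) (intro continuous_intros continuous_on_pos_of)
qed

text \<open>The function under \<open>Bcontfun\<close> is continuous, so this is an honest definition; its
  values are given by \<open>apply_S_op\<close>.\<close>

definition S_op :: "C_interval \<Rightarrow> C_interval" where
  "S_op f = Bcontfun (\<lambda>x. integral {0..2 * pi}
     (\<lambda>t. apply_bcontfun f (at_pos t) * (1 + cos (pos_of x - t))))"

lemma apply_S_op:
  "apply_bcontfun (S_op f) x
    = integral {0..2 * pi} (\<lambda>t. apply_bcontfun f (at_pos t) * (1 + cos (pos_of x - t)))"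
proof -
  have "continuous_on UNIV (apply_bcontfun f)"
    using apply_bcontfun[of f] by (simp add: bcontfun_interval_iff)
  then show ?thesis
    using kernel_integral_continuous
    by (simp add: S_op_def Bcontfun_inverse bcontfun_interval_iff)
qed

definition range_cone :: "C_interval set" where
  "range_cone = range S_op \<inter> C_plus"

definition dense_subset :: "'a::topological_space set \<Rightarrow> 'a set \<Rightarrow> bool" where
  "dense_subset A B \<longleftrightarrow> A \<subseteq> B \<and> B \<subseteq> closure A"

definition finitely_generated_cone :: "'a::real_vector set \<Rightarrow> bool" where
  "finitely_generated_cone K \<longleftrightarrow>
    (\<exists>S. finite S \<and> S \<subseteq> K \<and>
      (\<forall>x\<in>K. \<exists>c :: 'a \<Rightarrow> real. (\<forall>s\<in>S. 0 \<le> c s) \<and> x = (\<Sum>s\<in>S. c s *\<^sub>R s)))"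

end

theory Submission
  imports Defs
begin

text \<open>The range of the operator consists of trigonometric polynomials
  \<open>a + b cos x + c sin x = (a - r) + r (1 + cos (x - \<theta>))\<close>, where \<open>r \<ge> 0\<close>, and such a function is
  nonnegative iff \<open>a \<ge> r\<close>. Constants are images of constants, and \<open>1 + cos (x - \<theta>)\<close> is a uniform
  limit of images of normalised tents concentrated at \<open>\<theta>\<close>; this gives density. On the other hand,
  every image \<open>g\<close> of a nonnegative function with \<open>g \<pi> = 0\<close> also has \<open>g 0 = 0\<close>. If finitely many
  such images generated the cone, there would hence be \<open>e > 0\<close> with \<open>e * g 0 \<le> g \<pi>\<close> for all \<open>g\<close> in
  the cone, which fails for the images approximating \<open>1 + cos x\<close>.\<close>

section \<open>Linearity, positivity and finite rank of the operator\<close>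

lemma continuous_on_apply_at_pos:
  fixes f :: C_interval
  shows "continuous_on {0..2 * pi} (\<lambda>t. apply_bcontfun f (at_pos t))"
proof -
  have "continuous_on UNIV (apply_bcontfun f)"
    using apply_bcontfun[of f] by (simp add: bcontfun_interval_iff)
  from continuous_on_compose2[OF this continuous_on_at_pos] show ?thesis
    by simp
qed

lemma S_op_integrable:
  "(\<lambda>t. apply_bcontfun f (at_pos t) * (1 + cos (y - t))) integrable_on {0..2 * pi}"
  by (intro integrable_continuous_interval continuous_intros continuous_on_apply_at_pos)

lemma S_op_add: "S_op (f + g) = S_op f + S_op g"
  by (rule bcontfun_eqI)
    (simp add: apply_S_op distrib_right integral_add[OF S_op_integrable S_op_integrable])

lemma S_op_scaleR: "S_op (c *\<^sub>R f) = c *\<^sub>R S_op f"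
  by (rule bcontfun_eqI) (simp add: apply_S_op mult.assoc)

lemma S_op_C_plus_add:
  assumes "g \<in> S_op ` C_plus" "h \<in> S_op ` C_plus"
  shows "g + h \<in> S_op ` C_plus"
proof -
  obtain u v where "u \<in> C_plus" "v \<in> C_plus" "g = S_op u" "h = S_op v"
    using assms by auto
  then show ?thesis
    by (intro image_eqI[of _ _ "u + v"]) (auto simp: S_op_add C_plus_def)
qed

lemma S_op_C_plus_scaleR:
  assumes "g \<in> S_op ` C_plus" "0 \<le> c"
  shows "c *\<^sub>R g \<in> S_op ` C_plus"
proof -
  obtain u where "u \<in> C_plus" "g = S_op u"
    using assms by auto
  then show ?thesis
    using assms(2) by (intro image_eqI[of _ _ "c *\<^sub>R u"]) (auto simp: S_op_scaleR C_plus_def)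
qed

lemma S_op_integrand_nonneg:
  assumes "f \<in> C_plus"
  shows "0 \<le> apply_bcontfun f (at_pos t) * (1 + cos y)"
proof -
  have "-1 \<le> cos y" by simp
  then have "0 \<le> 1 + cos y" by linarith
  then show ?thesis
    using assms by (simp add: C_plus_def)
qed

lemma S_op_C_plus_subset: "S_op ` C_plus \<subseteq> C_plus"
proof
  fix g assume "g \<in> S_op ` C_plus"
  then obtain f where f: "f \<in> C_plus" "g = S_op f" by auto
  have "0 \<le> apply_bcontfun g x" for x
    unfolding f(2) apply_S_op
    by (intro integral_nonneg S_op_integrable S_op_integrand_nonneg f(1))
  then show "g \<in> C_plus"
    by (simp add: C_plus_def)
qed

text \<open>The addition formula for cos separates the variables of the kernel, so every image lies
  in the span of 1, cos and sin.\<close>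

lemma apply_S_op_trig:
  "apply_bcontfun (S_op f) x = integral {0..2 * pi} (\<lambda>t. apply_bcontfun f (at_pos t))
     + (cos (pos_of x) * integral {0..2 * pi} (\<lambda>t. apply_bcontfun f (at_pos t) * cos t)
      + sin (pos_of x) * integral {0..2 * pi} (\<lambda>t. apply_bcontfun f (at_pos t) * sin t))"
proof -
  let ?f = "\<lambda>t. apply_bcontfun f (at_pos t)"
  have 1: "?f integrable_on {0..2 * pi}"
    by (intro integrable_continuous_interval continuous_on_apply_at_pos)
  have 2: "(\<lambda>t. cos (pos_of x) * (?f t * cos t)) integrable_on {0..2 * pi}"
    by (intro integrable_continuous_interval continuous_intros continuous_on_apply_at_pos)
  have 3: "(\<lambda>t. sin (pos_of x) * (?f t * sin t)) integrable_on {0..2 * pi}"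
    by (intro integrable_continuous_interval continuous_intros continuous_on_apply_at_pos)
  have "(\<lambda>t. ?f t * (1 + cos (pos_of x - t)))
      = (\<lambda>t. ?f t + (cos (pos_of x) * (?f t * cos t) + sin (pos_of x) * (?f t * sin t)))"
    by (auto simp: cos_diff algebra_simps)
  then show ?thesis
    by (simp add: apply_S_op integral_add[OF 1 integrable_add[OF 2 3]] integral_add[OF 2 3])
qed

section \<open>Approximation of translates of the kernel\<close>

lemma abs_cos_diff_le: "\<bar>cos a - cos b\<bar> \<le> \<bar>a - b\<bar>" for a b :: real
proof -
  have "\<bar>cos a - cos b\<bar> = 2 * (\<bar>sin ((a + b) / 2)\<bar> * \<bar>sin ((b - a) / 2)\<bar>)"
    by (simp add: cos_diff_cos abs_mult)
  also have "\<dots> \<le> 2 * (1 * \<bar>(b - a) / 2\<bar>)"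
    by (intro mult_left_mono mult_mono abs_sin_x_le_abs_x) auto
  finally show ?thesis by simp
qed

text \<open>The image of a probability density supported within \<open>d\<close> of \<theta>
  averages the kernel over parameters within \<open>d\<close> of \<theta>. Since cos is 1-Lipschitz,
  this moves each value by at most \<open>d\<close>.\<close>

lemma S_op_approx_kernel:
  assumes "0 \<le> \<theta>" "\<theta> \<le> 2 * pi" "0 < d"
  shows "\<exists>g \<in> S_op ` C_plus. \<forall>x. \<bar>apply_bcontfun g x - (1 + cos (pos_of x - \<theta>))\<bar> \<le> d"
proof -
  let ?J = "{0..2 * pi}"
  define w where "w t = max 0 (d - \<bar>t - \<theta>\<bar>)" for t :: real
  have w_cont: "continuous_on A w" for A
    unfolding w_def by (intro continuous_intros)
  have w_nonneg: "0 \<le> w t" for t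
    by (simp add: w_def)
  define c where "c = integral ?J w"
  have w_int: "w integrable_on ?J"
    by (intro integrable_continuous_interval w_cont)
  \<comment> \<open>A continuous nonnegative function with integral 0 vanishes throughout the
    interval, whereas \<open>w\<close> equals \<open>d\<close> at \<theta>. This also covers an
    endpoint \<theta>, where part of the tent is cut off.\<close>
  have "c \<noteq> 0"
  proof
    assume "c = 0"
    then have "w \<theta> = 0"
      using integral_eq_0_iff[OF w_cont] assms w_nonneg
      by (auto simp: c_def)
    then show False using assms by (simp add: w_def)
  qed
  then have c: "c > 0"
    using integral_nonneg[OF w_int w_nonneg] by (simp add: c_def)
  have "continuous_on UNIV (\<lambda>x. w (pos_of x) / c)"
    by (intro continuous_intros continuous_on_compose2[OF w_cont continuous_on_pos_of])
      (use c in auto)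
  then have "(\<lambda>x. w (pos_of x) / c) \<in> bcontfun"
    by (simp add: bcontfun_interval_iff)
  then obtain f where f: "apply_bcontfun f = (\<lambda>x. w (pos_of x) / c)"
    using Bcontfun_inverse by metis
  have "f \<in> C_plus"
    using c w_nonneg by (simp add: C_plus_def f)
  moreover have "\<bar>apply_bcontfun (S_op f) x - (1 + cos (pos_of x - \<theta>))\<bar> \<le> d" for x
  proof -
    let ?y = "pos_of x"
    have i1: "(\<lambda>t. w t / c * (1 + cos (?y - t))) integrable_on ?J"
      by (intro integrable_continuous_interval continuous_intros w_cont) (use c in auto)
    have one: "((\<lambda>t. w t / c) has_integral 1) ?J"
      using has_integral_divide[OF integrable_integral[OF w_int], of c] c by (simp add: c_def)
    have val: "apply_bcontfun (S_op f) x = integral ?J (\<lambda>t. w t / c * (1 + cos (?y - t)))"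
      unfolding apply_S_op f by (rule integral_cong) (simp add: at_pos_inverse)
    \<comment> \<open>As \<open>w t / c\<close> has integral 1, the target value is itself an
      integral against it, and the two integrands can be compared pointwise.\<close>
    have diff: "((\<lambda>t. w t / c * (1 + cos (?y - t)) - w t / c * (1 + cos (?y - \<theta>)))
        has_integral apply_bcontfun (S_op f) x - 1 * (1 + cos (?y - \<theta>))) ?J"
      unfolding val by (intro has_integral_diff integrable_integral i1 has_integral_mult_left one)
    have bound: "((\<lambda>t. w t / c * d) has_integral 1 * d) ?J"
      by (intro has_integral_mult_left one)
    have pointwise: "norm (w t / c * (1 + cos (?y - t)) - w t / c * (1 + cos (?y - \<theta>)))
        \<le> w t / c * d" for t
    proof (cases "\<bar>t - \<theta>\<bar> \<le> d")
      case True
      have "\<bar>cos (?y - t) - cos (?y - \<theta>)\<bar> \<le> d"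
        using abs_cos_diff_le[of "?y - t" "?y - \<theta>"] True by linarith
      then have "w t / c * \<bar>cos (?y - t) - cos (?y - \<theta>)\<bar> \<le> w t / c * d"
        using c w_nonneg by (intro mult_left_mono) auto
      moreover have "w t / c * (1 + cos (?y - t)) - w t / c * (1 + cos (?y - \<theta>))
          = w t / c * (cos (?y - t) - cos (?y - \<theta>))"
        by (simp only: right_diff_distrib[symmetric]) simp
      moreover have "\<bar>w t / c\<bar> = w t / c"
        using c w_nonneg by simp
      ultimately show ?thesis by (simp only: real_norm_def abs_mult)
    next
      case False
      then show ?thesis by (simp add: w_def)
    qed
    show ?thesis
      using integral_norm_bound_integral[OF has_integral_integrable[OF diff]
          has_integral_integrable[OF bound] pointwise]
      unfolding integral_unique[OF diff] integral_unique[OF bound] by simp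
  qed
  ultimately show ?thesis by blast
qed

section \<open>Density in the range cone\<close>

lemma const_in_S_op_C_plus:
  assumes "0 \<le> a"
  shows "const_bcontfun a \<in> S_op ` C_plus"
proof (rule image_eqI)
  \<comment> \<open>Over a full period cos and sin integrate to 0, so only the first term of
    \<open>apply_S_op_trig\<close> survives for a constant.\<close>
  have "integral {0..2 * pi} cos = sin (2 * pi) - sin 0"
    by (intro integral_unique fundamental_theorem_of_calculus)
      (auto intro!: derivative_eq_intros simp: has_real_derivative_iff_has_vector_derivative[symmetric])
  moreover have "integral {0..2 * pi} sin = - cos (2 * pi) - - cos 0"
    by (intro integral_unique fundamental_theorem_of_calculus)
      (auto intro!: derivative_eq_intros simp: has_real_derivative_iff_has_vector_derivative[symmetric])
  ultimately show "const_bcontfun a = S_op (const_bcontfun (a / (2 * pi)))"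
    by (intro bcontfun_eqI) (simp add: apply_S_op_trig)
  show "const_bcontfun (a / (2 * pi)) \<in> C_plus"
    using assms by (simp add: C_plus_def)
qed

text \<open>Polar coordinates of the cos and sin coefficients give amplitude \<open>r\<close> and
  phase \<theta>. Nonnegativity at the minimum gives \<open>r \<le> a\<close>.\<close>

lemma range_cone_form:
  assumes "g \<in> range_cone"
  obtains a r \<theta> where "0 \<le> r" "r \<le> a" "0 \<le> \<theta>" "\<theta> \<le> 2 * pi"
    "\<And>x. apply_bcontfun g x = (a - r) + r * (1 + cos (pos_of x - \<theta>))"
proof -
  obtain f where g: "g = S_op f" "g \<in> C_plus"
    using assms by (auto simp: range_cone_def)
  obtain a b c where abc: "\<And>x. apply_bcontfun g x = a + (cos (pos_of x) * b + sin (pos_of x) * c)"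
    using apply_S_op_trig[of f] g(1) by metis
  define r where "r = sqrt (b\<^sup>2 + c\<^sup>2)"
  obtain \<theta> where \<theta>: "0 \<le> \<theta>" "\<theta> \<le> 2 * pi" "b = r * cos \<theta>" "c = r * sin \<theta>"
  proof (cases "r = 0")
    case True
    then have "b = 0" "c = 0" by (auto simp: r_def sum_power2_eq_zero_iff)
    then show ?thesis using that[of 0] True by simp
  next
    case False
    then have "(b / r)\<^sup>2 + (c / r)\<^sup>2 = 1"
      by (simp add: r_def power_divide add_divide_distrib[symmetric])
    then obtain t where "0 \<le> t" "t < 2 * pi" "b / r = cos t" "c / r = sin t"
      using sincos_total_2pi by metis
    then show ?thesis using that[of t] False by (simp add: field_simps)
  qed
  have form: "apply_bcontfun g x = (a - r) + r * (1 + cos (pos_of x - \<theta>))" for x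
    by (simp add: abc \<theta>(3,4) cos_diff algebra_simps)
  \<comment> \<open>The point opposite to \<theta> on the circle, with the sign of the shift chosen
    to stay in the interval.\<close>
  define p where "p = (if \<theta> \<le> pi then \<theta> + pi else \<theta> - pi)"
  have "p \<in> {0..2 * pi}" "cos (p - \<theta>) = -1"
    using \<theta> by (auto simp: p_def)
  then have "apply_bcontfun g (at_pos p) = a - r"
    by (simp add: form at_pos_inverse)
  then have "r \<le> a"
    using g(2) by (metis C_plus_def diff_ge_0_iff_ge mem_Collect_eq)
  moreover have "0 \<le> r" by (simp add: r_def)
  ultimately show ?thesis using that \<theta>(1,2) form by blast
qed

lemma range_cone_subset_closure: "range_cone \<subseteq> closure (S_op ` C_plus)"
proof
  fix g assume g_range: "g \<in> range_cone"
  obtain a r \<theta> where r: "0 \<le> r" "r \<le> a" and \<theta>: "0 \<le> \<theta>" "\<theta> \<le> 2 * pi"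
    and g: "\<And>x. apply_bcontfun g x = (a - r) + r * (1 + cos (pos_of x - \<theta>))"
    using range_cone_form[OF g_range] by metis
  show "g \<in> closure (S_op ` C_plus)"
    unfolding closure_approachable
  proof (intro allI impI)
    fix e :: real assume "0 < e"
    \<comment> \<open>The kernel error gets multiplied by \<open>r\<close>; the summand 1 keeps the
      denominator positive when \<open>r\<close> is 0.\<close>
    define d where "d = e / (2 * (r + 1))"
    have "0 < d" using \<open>0 < e\<close> r(1) by (simp add: d_def)
    then obtain h where h: "h \<in> S_op ` C_plus"
      "\<And>x. \<bar>apply_bcontfun h x - (1 + cos (pos_of x - \<theta>))\<bar> \<le> d"
      using S_op_approx_kernel[OF \<theta>] by blast
    let ?k = "const_bcontfun (a - r) + r *\<^sub>R h"
    have "dist (apply_bcontfun ?k x) (apply_bcontfun g x) \<le> r * d" for x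
    proof -
      have "apply_bcontfun ?k x - apply_bcontfun g x
          = r * (apply_bcontfun h x - (1 + cos (pos_of x - \<theta>)))"
        by (simp add: g algebra_simps)
      then show ?thesis
        using mult_left_mono[OF h(2)[of x] r(1)] r(1) by (simp add: dist_real_def abs_mult)
    qed
    then have "dist ?k g \<le> r * d" by (rule dist_bound)
    also have "\<dots> \<le> (r + 1) * d" using \<open>0 < d\<close> by simp
    also have "\<dots> = e / 2" using r(1) by (simp add: d_def field_simps)
    also have "\<dots> < e" using \<open>0 < e\<close> by simp
    finally have "dist ?k g < e" .
    moreover have "?k \<in> S_op ` C_plus"
      using r by (intro S_op_C_plus_add S_op_C_plus_scaleR const_in_S_op_C_plus h(1)) auto
    ultimately show "\<exists>y\<in>S_op ` C_plus. dist y g < e" by blast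
  qed
qed

section \<open>Failure of finite generation\<close>

lemma S_op_vanish:
  assumes "f \<in> C_plus" "apply_bcontfun (S_op f) (at_pos pi) = 0"
  shows "apply_bcontfun (S_op f) (at_pos 0) = 0"
proof -
  let ?f = "\<lambda>t. apply_bcontfun f (at_pos t)"
  have pos: "pos_of (at_pos pi) = pi" "pos_of (at_pos 0) = 0"
    by (simp_all add: at_pos_inverse)
  have "integral {0..2 * pi} (\<lambda>t. ?f t * (1 + cos (pi - t))) = 0"
    using assms(2) by (simp add: apply_S_op pos)
  moreover have "continuous_on {0..2 * pi} (\<lambda>t. ?f t * (1 + cos (pi - t)))"
    by (intro continuous_intros continuous_on_apply_at_pos)
  \<comment> \<open>The kernel factor here is \<open>1 - cos t\<close>, which vanishes only at the
    two endpoints. Hence \<open>f\<close> is zero off a null set, and the integral for the value at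
    0 vanishes too.\<close>
  ultimately have zero: "\<forall>t \<in> {0..2 * pi}. ?f t * (1 + cos (pi - t)) = 0"
    using integral_eq_0_iff S_op_integrand_nonneg[OF assms(1)] pi_gt_zero by fastforce
  have "?f t = 0" if "t \<in> {0..2 * pi} - {0, 2 * pi}" for t
  proof -
    have "0 < sin (t / 2)"
      using that by (intro sin_gt_zero) auto
    then have "cos t \<noteq> 1"
      using cos_double_sin[of "t / 2"] by simp
    then show ?thesis using zero that by fastforce
  qed
  then have "integral {0..2 * pi} (\<lambda>t. ?f t * (1 + cos (0 - t))) = integral {0..2 * pi} (\<lambda>t. 0)"
    by (intro integral_spike[of "{0, 2 * pi}"]) auto
  then show ?thesis by (simp add: apply_S_op pos)
qed

lemma not_finitely_generated: "\<not> finitely_generated_cone (S_op ` C_plus)"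
proof
  assume "finitely_generated_cone (S_op ` C_plus)"
  then obtain S where S: "finite S" "S \<subseteq> S_op ` C_plus"
    and gen: "\<And>g. g \<in> S_op ` C_plus \<Longrightarrow>
      \<exists>c :: C_interval \<Rightarrow> real. (\<forall>s\<in>S. 0 \<le> c s) \<and> g = (\<Sum>s\<in>S. c s *\<^sub>R s)"
    unfolding finitely_generated_cone_def by metis
  let ?z = "at_pos 0" and ?p = "at_pos pi"
  \<comment> \<open>Each generator admits its own positive constant, by \<open>S_op_vanish\<close>
    if its value at \<open>pi\<close> is 0. Finiteness keeps the minimum of these constants
    positive.\<close>
  have "\<exists>e>0. \<forall>s\<in>S. e * apply_bcontfun s ?z \<le> apply_bcontfun s ?p"
    using S(1) S(2)
  proof (induction S)
    case empty
    then show ?case by (auto intro: exI[of _ 1])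
  next
    case (insert s S)
    then obtain e where e: "e > 0" "\<And>s. s \<in> S \<Longrightarrow> e * apply_bcontfun s ?z \<le> apply_bcontfun s ?p"
      by auto
    have nonneg: "0 \<le> apply_bcontfun u x" if "u \<in> insert s S" for u x
      using that insert.prems S_op_C_plus_subset unfolding C_plus_def by blast
    obtain e' where e': "e' > 0" "e' * apply_bcontfun s ?z \<le> apply_bcontfun s ?p"
    proof (cases "apply_bcontfun s ?p = 0")
      case True
      then have "apply_bcontfun s ?z = 0"
        using insert.prems S_op_vanish by blast
      then show ?thesis using that[of 1] True by simp
    next
      case False
      then have "apply_bcontfun s ?p > 0" using nonneg[of s ?p] by simp
      moreover have "apply_bcontfun s ?z \<ge> 0" using nonneg by simp
      ultimately show ?thesis
        \<comment> \<open>Adding 1 avoids division by zero when the value at 0 vanishes.\<close>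
        by (intro that[of "apply_bcontfun s ?p / (apply_bcontfun s ?z + 1)"])
          (auto simp: field_simps)
    qed
    have "min e e' * apply_bcontfun u ?z \<le> apply_bcontfun u ?p" if "u \<in> insert s S" for u
    proof (cases "u = s")
      case True
      then show ?thesis
        using e'(2) mult_right_mono[of "min e e'" e' "apply_bcontfun s ?z"] nonneg[of s ?z] by simp
    next
      case False
      then show ?thesis
        using e(2)[of u] mult_right_mono[of "min e e'" e "apply_bcontfun u ?z"] nonneg[OF that, of ?z] that
        by auto
    qed
    then show ?case using e(1) e'(1) by (intro exI[of _ "min e e'"]) auto
  qed
  then obtain e where e: "e > 0" "\<And>s. s \<in> S \<Longrightarrow> e * apply_bcontfun s ?z \<le> apply_bcontfun s ?p"
    by blast
  have apply_sum: "apply_bcontfun (\<Sum>s\<in>A. c s *\<^sub>R s) x = (\<Sum>s\<in>A. c s * apply_bcontfun s x)"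
    for A and c :: "C_interval \<Rightarrow> real" and x
    by (induction A rule: infinite_finite_induct) auto
  \<comment> \<open>The inequality is linear in the function, so it passes to nonnegative
    combinations of generators.\<close>
  have cone: "e * apply_bcontfun g ?z \<le> apply_bcontfun g ?p" if g: "g \<in> S_op ` C_plus" for g
  proof -
    obtain c where c: "\<forall>s\<in>S. 0 \<le> c s" "g = (\<Sum>s\<in>S. c s *\<^sub>R s)"
      using gen[OF g] by auto
    have "c s * (e * apply_bcontfun s ?z) \<le> c s * apply_bcontfun s ?p" if "s \<in> S" for s
      using c(1) e(2)[OF that] that by (intro mult_left_mono) auto
    then show ?thesis
      unfolding c(2) apply_sum sum_distrib_left by (intro sum_mono) (simp add: mult.left_commute)
  qed
  \<comment> \<open>A \<open>d\<close>-approximation of \<open>1 + cos x\<close> is at least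
    \<open>2 - d\<close> at 0 and at most \<open>d\<close> at \<open>pi\<close>, so the cone
    inequality would give \<open>2 * e \<le> d * (1 + e)\<close>. This \<open>d\<close> makes the
    right side equal to \<open>e\<close>.\<close>
  define d where "d = e / (1 + e)"
  have d: "0 < d" using e(1) by (simp add: d_def)
  obtain g where g: "g \<in> S_op ` C_plus" "\<And>x. \<bar>apply_bcontfun g x - (1 + cos (pos_of x - 0))\<bar> \<le> d"
    using S_op_approx_kernel[of 0 d] d by auto
  have "apply_bcontfun g ?p \<le> d" "2 - d \<le> apply_bcontfun g ?z"
    using g(2)[of ?p] g(2)[of ?z] by (auto simp: at_pos_inverse)
  then have "e * (2 - d) \<le> d"
    using cone[OF g(1)] e(1) mult_left_mono[of "2 - d" "apply_bcontfun g ?z" e] by linarith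
  then have "2 * e \<le> d * (1 + e)" by (simp add: algebra_simps)
  also have "\<dots> = e" using e(1) by (simp add: d_def)
  finally show False using e(1) by simp
qed

theorem corollary5p4:
  shows "dense_subset (S_op ` C_plus) range_cone \<and> \<not> finitely_generated_cone (S_op ` C_plus)"
  using S_op_C_plus_subset range_cone_subset_closure not_finitely_generated
  by (auto simp: dense_subset_def range_cone_def)

end
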